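(* Let $n\in\mathbb{N}$, $n\geq 10$, and let $C^0_n=\{x_0,x_1,\dots,x_n\}$ be the circle of radius $n$ with centre $x_0$, regarded as a pointed metric space with base point $0:=x_0$. Let $\mu_0,\mu_1,\dots,\mu_n$ be distinct points of $C^0_n$ with $\mu_0=0$, and let $\varphi_i:C^0_n\to C^0_n$, $i\in\{0,1,\dots,n\}$, be retractions such that $\varphi_i(C^0_n)=\{\mu_0,\dots,\mu_i\}$ for every $i\in\{0,\dots,n\}$, and $\varphi_i\varphi_j=\varphi_j\varphi_i=\varphi_i$ whenever $0\le i\leq j\le n$. Then there is an $s\in\{1,\dots,n\}$ such that $$\operatorname{Lip}\varphi_s\geq\frac{\sqrt{8n+1}-1}{8}.$$
   Context: For $n\in\mathbb{N}$, the circle of radius $n$ with centre $x_0$ is the set $C^0_n=\{x_0,x_1,\dots,x_n\}$ of $n+1$ distinct points with the metric $d(x_k,x_0)=n$ for $k\neq 0$ and $d(x_k,x_l)=\min\{|k-l|,\,n-|k-l|\}$ for $k,l\geq 1$. A retraction on a metric space $M$ is a map $\varphi:M\to M$ with $\varphi(x)=x$ for every $x\in\varphi(M)$. $\operatorname{Lip}\varphi$ denotes the least Lipschitz constant of $\varphi$. *)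

theory Defs
  imports "HOL-Analysis.Abstract_Metric_Spaces"
begin

text \<open>
  A metric space \<^term>\<open>C\<close> whose points are exactly the distinct points
  \<open>x 0, \<dots>, x n\<close>, where \<open>x 0\<close> is the centre and \<open>x 1, \<dots>, x n\<close> lie on the circle.
\<close>

definition circle_with_centre :: "nat \<Rightarrow> (nat \<Rightarrow> 'a) \<Rightarrow> 'a metric \<Rightarrow> bool" where
  "circle_with_centre n x C \<longleftrightarrow>
     inj_on x {0..n} \<and>
     mspace C = x ` {0..n} \<and>
     (\<forall>k\<in>{1..n}. mdist C (x k) (x 0) = real n) \<and>
     (\<forall>k\<in>{1..n}. \<forall>l\<in>{1..n}. mdist C (x k) (x l) =
        min \<bar>real k - real l\<bar> (real n - \<bar>real k - real l\<bar>))"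

text \<open>Set-theoretic retractions: no continuity is required.\<close>

definition metric_retraction :: "'a metric \<Rightarrow> ('a \<Rightarrow> 'a) \<Rightarrow> bool" where
  "metric_retraction M \<phi> \<longleftrightarrow>
     \<phi> \<in> mspace M \<rightarrow> mspace M \<and> (\<forall>y\<in>\<phi> ` mspace M. \<phi> y = y)"

text \<open>
  The infimum is attained whenever some Lipschitz constant exists, in particular on every
  finite space. Otherwise the value is unspecified.
\<close>

definition Lip :: "'a metric \<Rightarrow> 'b metric \<Rightarrow> ('a \<Rightarrow> 'b) \<Rightarrow> real" where
  "Lip M N f = Inf {L. 0 \<le> L \<and>
     (\<forall>y\<in>mspace M. \<forall>z\<in>mspace M. mdist N (f y) (f z) \<le> L * mdist M y z)}"

text \<open>The prescribed distances do define a metric, so such circles exist for every \<open>n\<close>.\<close>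

lemma circle_with_centre_exists: "\<exists>C. circle_with_centre n (\<lambda>k. k) C"
proof -
  define d :: "nat \<Rightarrow> nat \<Rightarrow> real" where
    "d k l = (if k = l then 0 else if k = 0 \<or> l = 0 then real n
              else min \<bar>real k - real l\<bar> (real n - \<bar>real k - real l\<bar>))" for k l
  define e where "e k l = (if k \<in> {0..n} \<and> l \<in> {0..n} then d k l else 0)" for k l
  have nonneg: "0 \<le> e k l" for k l
    by (auto simp: e_def d_def)
  have sym: "e k l = e l k" for k l
    by (auto simp: e_def d_def abs_minus_commute)
  have zero: "e k l = 0 \<longleftrightarrow> k = l" if "k \<in> {0..n}" "l \<in> {0..n}" for k l
    using that by (auto simp: e_def d_def min_def abs_if)
  have tri: "e k m \<le> e k l + e l m" if "k \<in> {0..n}" "l \<in> {0..n}" "m \<in> {0..n}" for k l m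
    using that by (auto simp: e_def d_def min_def abs_if)
  interpret Metric_space "{0..n}" e
    by standard (use nonneg sym zero tri in auto)
  have "circle_with_centre n (\<lambda>k. k) (metric ({0..n}, e))"
    by (auto simp: circle_with_centre_def e_def d_def)
  then show ?thesis ..
qed

end

theory Submission
  imports Defs "HOL-Number_Theory.Cong"
begin

text \<open>
  The bound holds because the circle is not contractible. In fact a linear bound holds:
  some \<open>\<phi> s\<close> has \<open>Lip (\<phi> s) \<ge> n / 6\<close>, and \<open>n / 6\<close> exceeds \<open>(sqrt (8 n + 1) - 1) / 8\<close>.

  Suppose that every \<open>\<phi> s\<close> with \<open>s \<ge> 1\<close> has Lipschitz constant below \<open>r = n / 6\<close>. Then it moves
  neighbours on the circle to points at distance less than \<open>r\<close>. The centre is at distance \<open>n\<close>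
  from the circle, so if \<open>\<phi> s\<close> sent one circle point to the centre, it would send its
  neighbours and hence the whole circle there; but it fixes \<open>\<mu> 1\<close>. Therefore \<open>\<phi> s\<close> maps
  the circle to itself, and reading it along the circle gives a discrete loop with steps shorter
  than \<open>r\<close>. For \<open>s = 1\<close> this loop is constant; for \<open>s = n\<close> it runs once around the
  circle.

  Consecutive loops are uniformly close. Indeed \<open>\<phi> s\<close> and \<open>\<phi> (s - 1)\<close> differ only at points
  that \<open>\<phi> s\<close> sends to \<open>\<mu> s\<close>, and there \<open>\<phi> (s - 1)\<close> takes the value
  \<open>p = \<phi> (s - 1) (\<mu> s)\<close>. Going around the circle, one meets neighbours \<open>y\<close>, \<open>z\<close> with
  \<open>\<phi> s y = \<mu> s\<close> and \<open>q = \<phi> s z \<noteq> \<mu> s\<close>. Then \<open>\<phi> (s - 1) y = p\<close> and \<open>\<phi> (s - 1) z = q\<close>,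
  so both \<open>\<mu> s\<close> and \<open>p\<close> are at distance less than \<open>r\<close> from \<open>q\<close>, and at distance less than
  \<open>2 r\<close> from each other. Since \<open>2 (2 r) + 2 r \<le> n\<close>, a lift of one loop to the integers that
  closes up can be pushed to such a lift of the next (\<open>null_loop_perturb\<close>). So the loop that runs
  once around the circle would have a lift that closes up, which is absurd
  (\<open>not_null_loop_once_around\<close>).
\<close>

section \<open>Lipschitz constants on finite spaces\<close>

text \<open>On a finite space the sum of all quotients of distances is a Lipschitz constant, so the
  infimum is over a nonempty set and is itself a Lipschitz constant.\<close>

lemma mdist_le_Lip:
  assumes fin: "finite (mspace M)" and f: "f \<in> mspace M \<rightarrow> mspace N"
    and y: "y \<in> mspace M" and z: "z \<in> mspace M"
  shows "mdist N (f y) (f z) \<le> Lip M N f * mdist M y z"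
proof (cases "y = z")
  case True
  have "f y \<in> mspace N" using f y by auto
  then have "mdist N (f y) (f z) = 0" using True by simp
  moreover have "mdist M y z = 0" using True y by simp
  ultimately show ?thesis by simp
next
  case False
  then have pos: "mdist M y z > 0" using y z mdist_nonneg[of M y z] by (simp add: less_le)
  define A where "A = {L. 0 \<le> L \<and>
     (\<forall>y\<in>mspace M. \<forall>z\<in>mspace M. mdist N (f y) (f z) \<le> L * mdist M y z)}"
  define q where "q = (\<lambda>(y, z). mdist N (f y) (f z) / mdist M y z)"
  have q0: "0 \<le> q u" for u by (auto simp: q_def split: prod.split)
  have "sum q (mspace M \<times> mspace M) \<in> A"
    unfolding A_def
  proof (intro CollectI conjI ballI)
    show "0 \<le> sum q (mspace M \<times> mspace M)" by (simp add: q0 sum_nonneg)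
  next
    fix a b assume ab: "a \<in> mspace M" "b \<in> mspace M"
    show "mdist N (f a) (f b) \<le> sum q (mspace M \<times> mspace M) * mdist M a b"
    proof (cases "a = b")
      case True
      have "f a \<in> mspace N" using f ab by auto
      then have "mdist N (f a) (f b) = 0" using True by simp
      moreover have "mdist M a b = 0" using True ab by simp
      ultimately show ?thesis by simp
    next
      case False
      have "q (a, b) \<le> sum q (mspace M \<times> mspace M)"
        using ab fin q0 by (intro member_le_sum) auto
      moreover have "mdist M a b > 0" using False ab mdist_nonneg[of M a b] by (simp add: less_le)
      ultimately show ?thesis by (simp add: q_def pos_divide_le_eq)
    qed
  qed
  then have "mdist N (f y) (f z) / mdist M y z \<le> Inf A"
    using y z pos by (intro cInf_greatest) (auto simp: A_def pos_divide_le_eq)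
  then show ?thesis using pos by (simp add: Lip_def A_def pos_divide_le_eq)
qed

section \<open>Discrete loops in the integers modulo n\<close>

definition cyc_close :: "nat \<Rightarrow> real \<Rightarrow> int \<Rightarrow> int \<Rightarrow> bool" where
  "cyc_close n r a b \<longleftrightarrow> (\<exists>e. \<bar>real_of_int e\<bar> < r \<and> [a = b + e] (mod int n))"

text \<open>A loop \<open>f 0, \<dots>, f n\<close> of residues has winding number zero if it lifts to a closed loop of
  integers with steps shorter than \<open>r\<close>. For \<open>2 r \<le> n\<close> the steps of such a lift are determined
  by \<open>f\<close>.\<close>

definition null_loop :: "nat \<Rightarrow> real \<Rightarrow> (nat \<Rightarrow> int) \<Rightarrow> bool" where
  "null_loop n r f \<longleftrightarrow> (\<exists>F. (\<forall>k\<le>n. [F k = f k] (mod int n)) \<and>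
     (\<forall>k<n. \<bar>real_of_int (F (Suc k) - F k)\<bar> < r) \<and> F n = F 0)"

lemma cong_eq_of_abs_less:
  fixes a b :: int
  assumes "[a = b] (mod int n)" and "\<bar>real_of_int a - real_of_int b\<bar> < real n"
  shows "a = b"
proof -
  have "int n dvd a - b" using assms(1) by (simp add: cong_iff_dvd_diff)
  moreover have "\<bar>a - b\<bar> < int n" using assms(2) by linarith
  ultimately have "a - b = 0" using zdvd_not_zless[of "\<bar>a - b\<bar>" "int n"] by fastforce
  then show ?thesis by simp
qed

text \<open>Homotopy invariance of the winding number: the lift of \<open>g\<close> is obtained by adding to the
  lift of \<open>f\<close> the short displacements from \<open>f\<close> to \<open>g\<close>. Its steps are then shorter than
  \<open>2 A + r\<close> and congruent to a number smaller than \<open>r\<close>, which they must equal.\<close>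

lemma null_loop_perturb:
  assumes f: "null_loop n r f" and loop: "f n = f 0" "g n = g 0"
    and close: "\<And>k. k \<le> n \<Longrightarrow> cyc_close n A (g k) (f k)"
    and steps: "\<And>k. k < n \<Longrightarrow> cyc_close n r (g (Suc k)) (g k)"
    and bound: "2 * A + 2 * r \<le> real n"
  shows "null_loop n r g"
proof -
  obtain F where F: "\<And>k. k \<le> n \<Longrightarrow> [F k = f k] (mod int n)"
      "\<And>k. k < n \<Longrightarrow> \<bar>real_of_int (F (Suc k) - F k)\<bar> < r" "F n = F 0"
    using f unfolding null_loop_def by blast
  obtain e where e: "\<And>k. k \<le> n \<Longrightarrow> \<bar>real_of_int (e k)\<bar> < A \<and> [g k = f k + e k] (mod int n)"
    using close unfolding cyc_close_def by metis
  \<comment> \<open>The displacement at the end of the loop has to be the one chosen at its beginning.\<close>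
  define G where "G k = F k + e (if k = n then 0 else k)" for k
  have G: "[G k = g k] (mod int n)" if "k \<le> n" for k
  proof (cases "k = n")
    case True
    then show ?thesis
      using cong_add[OF F(1)[of 0] cong_refl[of "e 0"]] e[of 0] F(3) loop
      by (simp add: G_def) (metis cong_sym cong_trans)
  next
    case False
    then show ?thesis
      using cong_add[OF F(1)[OF that] cong_refl[of "e k"]] e[OF that]
      by (simp add: G_def) (metis cong_sym cong_trans)
  qed
  have "\<bar>real_of_int (G (Suc k) - G k)\<bar> < r" if k: "k < n" for k
  proof -
    obtain d where d: "\<bar>real_of_int d\<bar> < r" "[g (Suc k) = g k + d] (mod int n)"
      using steps[OF k] unfolding cyc_close_def by blast
    have "[G (Suc k) - G k = g (Suc k) - g k] (mod int n)"
      using G k by (intro cong_diff) auto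
    also have "[g (Suc k) - g k = d] (mod int n)"
      using d(2) by (simp add: cong_iff_dvd_diff algebra_simps)
    finally have "[G (Suc k) - G k = d] (mod int n)" .
    moreover have "\<bar>real_of_int (e (if j = n then 0 else j))\<bar> < A" if "j \<le> n" for j
      using e[of 0] e[OF that] by simp
    from this[of k] this[of "Suc k"] have "\<bar>real_of_int (G (Suc k) - G k) - real_of_int d\<bar> < real n"
      using F(2)[OF k] d(1) bound k by (simp only: G_def) linarith
    ultimately have "G (Suc k) - G k = d" by (rule cong_eq_of_abs_less)
    then show ?thesis using d by simp
  qed
  moreover have "G n = G 0" using F(3) by (simp add: G_def)
  ultimately show ?thesis using G unfolding null_loop_def by blast
qed

text \<open>Every step of a lift has to be \<open>1\<close>, so the lift ends \<open>n\<close> above its start.\<close>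

lemma not_null_loop_once_around:
  assumes step: "\<And>k. k < n \<Longrightarrow> [f (Suc k) = f k + 1] (mod int n)"
    and n: "n > 0" and r: "r + 1 \<le> real n"
  shows "\<not> null_loop n r f"
proof
  assume "null_loop n r f"
  then obtain F where F: "\<And>k. k \<le> n \<Longrightarrow> [F k = f k] (mod int n)"
      "\<And>k. k < n \<Longrightarrow> \<bar>real_of_int (F (Suc k) - F k)\<bar> < r" "F n = F 0"
    unfolding null_loop_def by blast
  have "F (Suc k) - F k = 1" if k: "k < n" for k
  proof (rule cong_eq_of_abs_less)
    have "[F (Suc k) - F k = f (Suc k) - f k] (mod int n)"
      using F(1) k by (intro cong_diff) auto
    also have "[f (Suc k) - f k = 1] (mod int n)"
      using step[OF k] by (simp add: cong_iff_dvd_diff algebra_simps)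
    finally show "[F (Suc k) - F k = 1] (mod int n)" .
    show "\<bar>real_of_int (F (Suc k) - F k) - real_of_int 1\<bar> < real n"
      using F(2)[OF k] r by linarith
  qed
  then have "F k = F 0 + int k" if "k \<le> n" for k
    using that
  proof (induction k)
    case (Suc k)
    from Suc.prems Suc.IH Suc(2)[of k] show ?case by simp
  qed simp
  from this[of n] show False using F(3) n by simp
qed

text \<open>A walk from \<open>i\<close> reaches the translate \<open>j + i * n\<close> of \<open>j\<close>, so it loses \<open>P\<close> on the way.
  This finds neighbours on the circle that a retraction treats differently.\<close>

lemma periodic_exit:
  fixes P :: "nat \<Rightarrow> bool"
  assumes "P i" and "\<not> P j" and per: "\<And>k. P (k + n) = P k" and "n > 0"
  obtains k where "P k" and "\<not> P (Suc k)"
proof -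
  have "P (j + m * n) = P j" for m
    using per[of "j + m * n" for m] by (induction m) (simp_all add: add_ac)
  then have notP: "\<not> P (j + i * n)" using \<open>\<not> P j\<close> by simp
  have "\<exists>k. P k \<and> \<not> P (Suc k)"
  proof (rule ccontr)
    assume stay: "\<nexists>k. P k \<and> \<not> P (Suc k)"
    have "P (i + m)" for m using \<open>P i\<close> stay by (induction m) auto
    from this[of "j + i * n - i"] have "P (i + (j + i * n - i))" .
    moreover have "i \<le> j + i * n" using \<open>n > 0\<close> by (simp add: trans_le_add2)
    ultimately show False using notP by simp
  qed
  then show thesis using that by blast
qed

section \<open>Chains of retractions of the circle with centre\<close>

text \<open>The distance on the circle is the distance of residues modulo \<open>n\<close>.\<close>

lemma cyc_close_of_mdist:
  assumes C: "circle_with_centre n x C" and kl: "k \<in> {1..n}" "l \<in> {1..n}"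
    and d: "mdist C (x k) (x l) < r"
  shows "cyc_close n r (int k) (int l)"
proof -
  have m: "min \<bar>real k - real l\<bar> (real n - \<bar>real k - real l\<bar>) < r"
    using C kl d by (simp add: circle_with_centre_def)
  consider "\<bar>real k - real l\<bar> < r" | "k \<ge> l" "real n - (real k - real l) < r"
    | "k \<le> l" "real n - (real l - real k) < r"
    using m by (cases "k \<ge> l") (auto simp: min_def split: if_splits)
  then show ?thesis
  proof cases
    case 1
    then show ?thesis unfolding cyc_close_def by (intro exI[of _ "int k - int l"]) auto
  next
    case 2
    have "real k \<le> real n" "real l \<ge> 0" using kl by auto
    with 2 have "\<bar>real_of_int (int k - int l - int n)\<bar> < r" by simp
    then show ?thesis unfolding cyc_close_def
      by (intro exI[of _ "int k - int l - int n"]) (simp add: cong_iff_dvd_diff)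
  next
    case 3
    have "real l \<le> real n" "real k \<ge> 0" using kl by auto
    with 3 have "\<bar>real_of_int (int k - int l + int n)\<bar> < r" by simp
    then show ?thesis unfolding cyc_close_def
      by (intro exI[of _ "int k - int l + int n"]) (simp add: cong_iff_dvd_diff)
  qed
qed

text \<open>The constant \<open>6\<close> comes from \<open>null_loop_perturb\<close> with \<open>A = 2 r\<close>, where the requirement on
  the step bound becomes \<open>6 r \<le> n\<close>.\<close>

theorem retraction_chain_Lip_ge:
  fixes n :: nat and x \<mu> :: "nat \<Rightarrow> 'a" and C :: "'a metric" and \<phi> :: "nat \<Rightarrow> 'a \<Rightarrow> 'a"
  assumes n: "n \<ge> 2"
    and C: "circle_with_centre n x C"
    and inj\<mu>: "inj_on \<mu> {0..n}"
    and \<mu>: "\<mu> ` {0..n} \<subseteq> mspace C"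
    and \<mu>0: "\<mu> 0 = x 0"
    and retr: "\<And>i. i \<le> n \<Longrightarrow> metric_retraction C (\<phi> i)"
    and img: "\<And>i. i \<le> n \<Longrightarrow> \<phi> i ` mspace C = \<mu> ` {0..i}"
    and comp: "\<And>i j z. i \<le> j \<Longrightarrow> j \<le> n \<Longrightarrow> z \<in> mspace C \<Longrightarrow> \<phi> i (\<phi> j z) = \<phi> i z"
  shows "\<exists>s\<in>{1..n}. Lip C C (\<phi> s) \<ge> real n / 6"
proof (rule ccontr)
  assume "\<not> ?thesis"
  then have Lip: "Lip C C (\<phi> s) < real n / 6" if "s \<in> {1..n}" for s
    using that by force
  have injx: "inj_on x {0..n}" and sp: "mspace C = x ` {0..n}"
    using C by (auto simp: circle_with_centre_def)
  have centre: "mdist C (x k) (x 0) = real n" if "k \<in> {1..n}" for k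
    using C that by (auto simp: circle_with_centre_def)
  define r where "r = real n / 6"
  \<comment> \<open>The circle, parametrised with period \<open>n\<close>.\<close>
  define c where "c k = x (k mod n + 1)" for k
  define pos where "pos = inv_into {0..n} x"
  have idx: "k mod n + 1 \<in> {1..n}" for k using n by (simp add: Suc_le_eq)
  have cC: "c k \<in> mspace C" for k using idx[of k] unfolding c_def sp by (intro imageI) auto
  have c_per: "c (k + n) = c k" for k by (simp add: c_def)
  have c_step: "mdist C (c (Suc k)) (c k) = 1" for k
  proof -
    have "Suc k mod n = (if k mod n = n - 1 then 0 else Suc (k mod n))"
      using n by (auto simp: mod_Suc)
    moreover have "mdist C (c (Suc k)) (c k) =
        min \<bar>real (Suc k mod n) - real (k mod n)\<bar> (real n - \<bar>real (Suc k mod n) - real (k mod n)\<bar>)"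
      using C idx[of k] idx[of "Suc k"] unfolding c_def circle_with_centre_def by simp
    ultimately show ?thesis using n by (auto simp: of_nat_diff min_def split: if_splits)
  qed
  have c_surj: "\<exists>k. z = c k" if "z \<in> mspace C" "z \<noteq> x 0" for z
  proof -
    obtain m where m: "z = x m" "m \<le> n" using \<open>z \<in> mspace C\<close> sp by auto
    then have "m \<noteq> 0" using \<open>z \<noteq> x 0\<close> by metis
    with m show ?thesis by (intro exI[of _ "m - 1"]) (simp add: c_def)
  qed
  have maps: "\<phi> s z \<in> mspace C" if "s \<le> n" "z \<in> mspace C" for s z
    using retr that by (auto simp: metric_retraction_def)
  have fixed: "\<phi> s (\<mu> i) = \<mu> i" if "s \<le> n" "i \<le> s" for s i
  proof -
    have "\<mu> i \<in> \<phi> s ` mspace C" using img that by simp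
    then show ?thesis using retr[OF \<open>s \<le> n\<close>] unfolding metric_retraction_def by blast
  qed
  have \<mu>C: "\<mu> i \<in> mspace C" if "i \<le> n" for i using \<mu> that by auto
  have \<mu>_neq: "\<mu> i \<noteq> \<mu> j" if "i \<noteq> j" "i \<le> n" "j \<le> n" for i j
    using inj\<mu> that by (auto simp: inj_on_def)
  have c_\<mu>: "\<exists>k. \<mu> i = c k" if "i \<in> {1..n}" for i
    using c_surj[OF \<mu>C] \<mu>_neq[of i 0] \<mu>0 that by auto
  have short: "mdist C (\<phi> s (c (Suc k))) (\<phi> s (c k)) < r" if s: "s \<in> {1..n}" for s k
  proof -
    have "mdist C (\<phi> s (c (Suc k))) (\<phi> s (c k)) \<le> Lip C C (\<phi> s) * mdist C (c (Suc k)) (c k)"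
      using s maps cC sp by (intro mdist_le_Lip) auto
    then show ?thesis using Lip[OF s] by (simp add: c_step r_def)
  qed
  have circ: "\<phi> s (c k) \<noteq> x 0" if s: "s \<in> {1..n}" for s k
  proof
    assume "\<phi> s (c k) = x 0"
    moreover obtain j where "\<mu> 1 = c j" using c_\<mu>[of 1] n by auto
    then have "\<phi> s (c j) \<noteq> x 0" using fixed[of s 1] \<mu>_neq[of 1 0] \<mu>0 s by auto
    ultimately obtain i where i: "\<phi> s (c i) = x 0" "\<phi> s (c (Suc i)) \<noteq> x 0"
      using periodic_exit[of "\<lambda>k. \<phi> s (c k) = x 0" k j n] n c_per by auto
    have "\<phi> s (c (Suc i)) \<in> mspace C" using maps cC s by auto
    then obtain m where m: "\<phi> s (c (Suc i)) = x m" "m \<le> n" using sp by auto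
    then have "m \<noteq> 0" using i(2) by metis
    with m show False using short[OF s, of i] centre[of m] i(1) n by (simp add: r_def)
  qed
  \<comment> \<open>The value \<open>\<phi> s (\<mu> (Suc s))\<close> is compared with \<open>\<mu> (Suc s)\<close> through a point \<open>q\<close> near both.\<close>
  have consecutive: "mdist C (\<phi> (Suc s) (c k)) (\<phi> s (c k)) < 2 * r" if s: "s \<in> {1..<n}" for s k
  proof -
    have s': "Suc s \<in> {1..n}" "s \<in> {1..n}" "s \<le> n" "Suc s \<le> n" using s by auto
    have via: "\<phi> s (c i) = \<phi> s (\<phi> (Suc s) (c i))" for i
      using comp[of s "Suc s"] cC s' by simp
    have unmoved: "\<phi> s (\<phi> (Suc s) (c i)) = \<phi> (Suc s) (c i)"
      if "\<phi> (Suc s) (c i) \<noteq> \<mu> (Suc s)" for i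
    proof -
      have "\<phi> (Suc s) (c i) \<in> \<mu> ` {0..Suc s}" using img[OF s'(4)] cC by blast
      then obtain j where "\<phi> (Suc s) (c i) = \<mu> j" "j \<le> Suc s" by auto
      then show ?thesis using fixed[of s j] s' that by (metis le_Suc_eq)
    qed
    obtain i where "\<mu> (Suc s) = c i" using c_\<mu>[OF s'(1)] by blast
    then have i: "\<phi> (Suc s) (c i) = \<mu> (Suc s)" using fixed[of "Suc s" "Suc s"] s' by simp
    obtain j where "\<mu> 1 = c j" using c_\<mu>[of 1] n by auto
    then have j: "\<phi> (Suc s) (c j) \<noteq> \<mu> (Suc s)"
      using fixed[of "Suc s" 1] \<mu>_neq[of 1 "Suc s"] s' s by auto
    obtain l where l: "\<phi> (Suc s) (c l) = \<mu> (Suc s)" "\<phi> (Suc s) (c (Suc l)) \<noteq> \<mu> (Suc s)"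
      using periodic_exit[of "\<lambda>k. \<phi> (Suc s) (c k) = \<mu> (Suc s)" i j n] i j n c_per by auto
    define q where "q = \<phi> (Suc s) (c (Suc l))"
    have q: "q \<in> mspace C" "mdist C q (\<mu> (Suc s)) < r" "mdist C q (\<phi> s (\<mu> (Suc s))) < r"
      using maps cC s' short[OF s'(1), of l] short[OF s'(2), of l]
        via[of l] via[of "Suc l"] unmoved[OF l(2)] l(1)
      by (auto simp: q_def)
    have "mdist C (\<mu> (Suc s)) (\<phi> s (\<mu> (Suc s)))
        \<le> mdist C (\<mu> (Suc s)) q + mdist C q (\<phi> s (\<mu> (Suc s)))"
      using q \<mu>C maps s' by (intro mdist_triangle) auto
    then have jump: "mdist C (\<mu> (Suc s)) (\<phi> s (\<mu> (Suc s))) < 2 * r"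
      using q by (simp add: mdist_commute)
    show ?thesis
    proof (cases "\<phi> (Suc s) (c k) = \<mu> (Suc s)")
      case True
      then show ?thesis using jump via[of k] by simp
    next
      case False
      then have "\<phi> s (c k) = \<phi> (Suc s) (c k)" using via[of k] unmoved by simp
      then have "mdist C (\<phi> (Suc s) (c k)) (\<phi> s (c k)) = 0" using maps[OF s'(4) cC] by simp
      then show ?thesis using n by (simp add: r_def)
    qed
  qed
  have pos: "pos z \<in> {1..n}" "x (pos z) = z" if "z \<in> mspace C" "z \<noteq> x 0" for z
  proof -
    have z: "z \<in> x ` {0..n}" using that sp by simp
    show xz: "x (pos z) = z" using z by (simp add: pos_def f_inv_into_f)
    have "pos z \<in> {0..n}" using inv_into_into[OF z] by (simp add: pos_def)
    then show "pos z \<in> {1..n}" using xz \<open>z \<noteq> x 0\<close> by (cases "pos z = 0") auto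
  qed
  have close: "cyc_close n t (int (pos y)) (int (pos z))"
    if "mdist C y z < t" "y \<in> mspace C" "y \<noteq> x 0" "z \<in> mspace C" "z \<noteq> x 0" for y z t
    using cyc_close_of_mdist[OF C pos(1) pos(1)] pos(2) that by simp
  define loop where "loop s k = int (pos (\<phi> s (c k)))" for s k
  have closed: "loop s n = loop s 0" for s using c_per[of 0] by (simp add: loop_def)
  have null: "null_loop n r (loop s)" if "1 \<le> s" "s \<le> n" for s
    using that
  proof (induction s rule: dec_induct)
    case base
    have "\<phi> 1 (c k) = \<mu> 1" for k
    proof -
      have "\<phi> 1 (c k) \<in> \<mu> ` {0..1}" using img[of 1] cC n by auto
      then have "\<phi> 1 (c k) = \<mu> 0 \<or> \<phi> 1 (c k) = \<mu> 1" by (auto simp: le_Suc_eq)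
      then show ?thesis using circ[of 1 k] \<mu>0 n by simp
    qed
    then show ?case unfolding null_loop_def
      using n by (intro exI[of _ "loop 1"]) (simp add: loop_def r_def)
  next
    case (step s)
    then have s: "s \<in> {1..<n}" "s \<in> {1..n}" "Suc s \<in> {1..n}" by auto
    show ?case
    proof (rule null_loop_perturb[where A = "2 * r"])
      show "null_loop n r (loop s)" using step by simp
      show "cyc_close n (2 * r) (loop (Suc s) k) (loop s k)" for k
        unfolding loop_def using s maps cC
        by (intro close consecutive circ) auto
      show "cyc_close n r (loop (Suc s) (Suc k)) (loop (Suc s) k)" for k
        unfolding loop_def using s maps cC by (intro close short circ) auto
    qed (simp_all add: closed r_def)
  qed
  have "\<phi> n (c k) = c k" for k
  proof -
    have "\<mu> ` {0..n} = mspace C"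
      using \<mu> inj\<mu> injx by (intro card_subset_eq) (auto simp: sp card_image)
    then have "c k \<in> \<phi> n ` mspace C" using cC img[of n] by simp
    then show ?thesis using retr[of n] unfolding metric_retraction_def by blast
  qed
  then have "loop n k = int (k mod n + 1)" for k
    unfolding loop_def pos_def c_def using idx[of k] injx by simp
  then have "[loop n (Suc k) = loop n k + 1] (mod int n)" for k
    by (auto simp: cong_def zmod_int mod_simps)
  then have "\<not> null_loop n r (loop n)"
    using n by (intro not_null_loop_once_around) (auto simp: r_def)
  then show False using null[of n] n by simp
qed

theorem theorem5:
  fixes n :: nat
    and x \<mu> :: "nat \<Rightarrow> 'a"
    and C :: "'a metric"
    and \<phi> :: "nat \<Rightarrow> 'a \<Rightarrow> 'a"
  assumes "n \<ge> 10"
    and "circle_with_centre n x C"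
    and "inj_on \<mu> {0..n}"
    and "\<mu> ` {0..n} \<subseteq> mspace C"
    and "\<mu> 0 = x 0"
    and "\<And>i. i \<le> n \<Longrightarrow> metric_retraction C (\<phi> i)"
    and "\<And>i. i \<le> n \<Longrightarrow> \<phi> i ` mspace C = \<mu> ` {0..i}"
    and "\<And>i j z. i \<le> j \<Longrightarrow> j \<le> n \<Longrightarrow> z \<in> mspace C \<Longrightarrow>
           \<phi> i (\<phi> j z) = \<phi> i z \<and> \<phi> j (\<phi> i z) = \<phi> i z"
  shows "\<exists>s\<in>{1..n}. Lip C C (\<phi> s) \<ge> (sqrt (8 * real n + 1) - 1) / 8"
proof -
  have "\<exists>s\<in>{1..n}. Lip C C (\<phi> s) \<ge> real n / 6"
    using assms by (intro retraction_chain_Lip_ge[of n x C \<mu> \<phi>]) auto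
  moreover have "(sqrt (8 * real n + 1) - 1) / 8 \<le> real n / 6"
  proof -
    have "sqrt (8 * real n + 1) \<le> 1 + real n"
    proof (rule real_le_lsqrt)
      have "10 * real n \<le> real n * real n" using \<open>n \<ge> 10\<close> by (intro mult_right_mono) auto
      then show "8 * real n + 1 \<le> (1 + real n)\<^sup>2" by (simp add: power2_eq_square algebra_simps)
    qed simp_all
    then show ?thesis by simp
  qed
  ultimately show ?thesis by force
qed

end
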